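(* Let $n\ge 1$, $d\ge 1$, and let $U$ be a $d$-bounded multilinear set of nonconstant monomials in $n$ variables, i.e. a set of nonempty subsets of $[n]$ whose largest member has cardinality exactly $d$. Let $u=|U|$ and $u_i=|\{S\in U: i\in S\}|$ for $i\in[n]$, and let $\mathcal{L}_{U,\mathbb{R}}$ be the set of polynomials $h(x_1,\dots,x_n)=\sum_{S\in U}h_S\prod_{i\in S}x_i$ with every $h_S\in\{-1,1\}$. (i) For fixed $d$, $$\inf_{h\in\mathcal{L}_{U,\mathbb{R}}}\ \sup_{x\in[-1,1]^n}|h(x)|\ \in\ \Theta_d\Big(\sum_{i=1}^n\sqrt{u_i}\Big),$$ that is, for each $d\ge 1$ there are constants $0<c_d\le C_d<\infty$ depending only on $d$ such that for all $n$ and all such $U$ the left-hand side lies between $c_d\sum_{i=1}^n\sqrt{u_i}$ and $C_d\sum_{i=1}^n\sqrt{u_i}$. (ii) More precisely, and without assumptions on $d$, $$\max\left\{\frac{1}{3^{d-1}\,2^{5/2}\,(d-1)^{3/2}\,d}\sum_{i=1}^n\sqrt{u_i},\ \sqrt{u}\right\}\ \le\ \inf_{h\in\mathcal{L}_{U,\mathbb{R}}}\ \sup_{x\in[-1,1]^n}|h(x)|\ \le\ \min\left\{3.34\sum_{i=1}^n\sqrt{u_i},\ \sqrt{2(n+1)u}\right\},$$ where for $d=1$ the first term in the maximum (whose denominator vanishes) is omitted.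
   Context: $[n]=\{1,\dots,n\}$. A multilinear monomial in $x_1,\dots,x_n$ is identified with a subset $S\subseteq[n]$ via $x^S=\prod_{i\in S}x_i$; its degree is $|S|$. The constant (empty) monomial is always excluded from $U$. $U$ is called $d$-bounded if the maximum total degree of a monomial in $U$ is $d$. $\mathcal{L}_{U,\mathbb{R}}$ is called the real Littlewood family of $U$: the real polynomials whose set of monomials with nonzero coefficient is exactly $U$, with all these coefficients in $\{-1,1\}$. *)

theory Defs
  imports Complex_Main "HOL-Library.FuncSet"
begin

definition degree_bounded :: "nat \<Rightarrow> nat \<Rightarrow> nat set set \<Rightarrow> bool" where
  "degree_bounded n d U \<longleftrightarrow>
     U \<subseteq> Pow {1..n} - {{}} \<and> U \<noteq> {} \<and> Max (card ` U) = d"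

text \<open>A multilinear real polynomial is represented by its coefficient family: the number
  \<open>h S\<close> is the coefficient of the monomial \<open>\<Prod>i\<in>S. x i\<close>.  Only families of finite
  support represent polynomials.\<close>

type_synonym mlpoly = "nat set \<Rightarrow> real"

definition monomials :: "mlpoly \<Rightarrow> nat set set" where
  "monomials h = {S. h S \<noteq> 0}"

definition mleval :: "mlpoly \<Rightarrow> (nat \<Rightarrow> real) \<Rightarrow> real" where
  "mleval h x = (\<Sum>S\<in>monomials h. h S * (\<Prod>i\<in>S. x i))"

definition littlewood :: "nat set set \<Rightarrow> mlpoly set" where
  "littlewood U = {h. monomials h = U \<and> (\<forall>S\<in>U. h S \<in> {-1, 1})}"

definition cube :: "nat \<Rightarrow> (nat \<Rightarrow> real) set" where
  "cube n = {1..n} \<rightarrow>\<^sub>E {-1..1}"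

definition littlewood_min :: "nat \<Rightarrow> nat set set \<Rightarrow> real" where
  "littlewood_min n U = (INF h\<in>littlewood U. SUP x\<in>cube n. \<bar>mleval h x\<bar>)"

definition occ :: "nat set set \<Rightarrow> nat \<Rightarrow> nat" where
  "occ U i = card {S \<in> U. i \<in> S}"

end

theory Submission
  imports
    Defs
    "HOL-Analysis.Convex"
    "HOL-Analysis.L2_Norm"
    "HOL-Computational_Algebra.Polynomial"
begin

text \<open>Every bound is a statement about averages over independent uniform signs: the coefficients
of \<open>h\<close> are random for the upper bounds, the point of the cube is random for the lower bounds.
Since \<open>h\<close> is affine in each variable, its supremum over the cube is attained at a vertex
(\<open>abs_mlp_le_vertices\<close>), so both averages run over sign vectors.  Write \<open>u\<^sub>i\<close> for \<open>occ U i\<close>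
and \<open>u\<close> for \<open>card U\<close>.

Upper bounds.  For the bound \<open>sqrt (2 (n + 1) u)\<close>, each value \<open>h x\<close> at a vertex is a sum of
\<open>u\<close> random signs, hence subgaussian, and a union bound over the \<open>2^n\<close> vertices and the two signs
of \<open>h x\<close> suffices (\<open>exists_signs_union_bound\<close>).  This is wasteful when the \<open>u\<^sub>i\<close> are uneven.
For the bound by \<open>\<Sum>\<^sub>i sqrt u\<^sub>i\<close>, compare the process \<open>x \<mapsto> h x\<close> with a linear one.
Two vertices can differ in the monomial of \<open>S\<close> only if they differ in some coordinate in \<open>S\<close>,
and therefore replacing the random term \<open>\<epsilon>\<^sub>S (\<Prod>i\<in>S. x i)\<close> by \<open>\<Sum>i\<in>S. \<delta>\<^sub>i x i\<close> with fresh signs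
can only increase the expected maximum (\<open>Max_contraction\<close>, a discrete form of the Slepian comparison).
After all monomials have been replaced, \<open>x i\<close> is multiplied by a sum of \<open>u\<^sub>i\<close> random signs; the
maximum is the sum of the absolute values of these sums, of expectation at most
\<open>\<Sum>\<^sub>i sqrt u\<^sub>i\<close> (\<open>expect_Max_le\<close>).  One additional variable that multiplies the whole
polynomial turns the maximum of \<open>h\<close> into that of \<open>\<bar>h\<bar>\<close> and adds \<open>sqrt u\<close>, which is at most
\<open>\<Sum>\<^sub>i sqrt u\<^sub>i\<close>.  The constant obtained in this way is 2, which is less than 3.34.

Lower bounds.  The bound \<open>sqrt u\<close> is Parseval's identity at the vertices.  For the other one,
let \<open>M\<close> bound \<open>\<bar>h\<bar>\<close> on the cube and let \<open>D\<^sub>i\<close> be the partial derivatives of \<open>h\<close>.  On the segment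
from a vertex \<open>x\<close> to the point \<open>y\<close> with \<open>y\<^sub>i = sgn (D\<^sub>i x)\<close>, the polynomial \<open>h\<close> is univariate of
degree at most \<open>d\<close>, and Markov's inequality at an endpoint bounds its derivative there, which is
\<open>\<Sum>\<^sub>i \<bar>D\<^sub>i x\<bar> - \<Sum>\<^sub>i x\<^sub>i D\<^sub>i x\<close>, by \<open>2 d\<^sup>2 M\<close>.  The second sum has mean zero because \<open>D\<^sub>i\<close> does
not depend on \<open>x\<^sub>i\<close>.  Hence the total first-moment influence of \<open>h\<close> is at most \<open>2 d\<^sup>2 M\<close>
(\<open>total_L1_influence_le\<close>).  Finally \<open>D\<^sub>i\<close> has degree at most \<open>d - 1\<close> and second moment \<open>u\<^sub>i\<close>,
so by Bonami's fourth-moment inequality its first moment is at least \<open>sqrt u\<^sub>i / 3^(d-1)\<close>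
(\<open>sqrt_expect_square_le\<close>).  The resulting constant \<open>2 d\<^sup>2\<close> is at most
\<open>2 powr (5/2) * (d - 1) powr (3/2) * d\<close> once \<open>d \<ge> 2\<close>.\<close>

section \<open>Averages over random signs\<close>

text \<open>A sign vector is given by the set of positions of its entries \<open>-1\<close>.  Sign vectors serve both
as coefficients and as vertices of the cube; indexing them by sets makes \<open>Pow A\<close> the sample
space, on which a coordinate can be split off by \<open>sum_Pow_insert\<close>.\<close>
definition signs :: "'a set \<Rightarrow> 'a \<Rightarrow> real" where
  "signs T a = (if a \<in> T then -1 else 1)"

definition expect :: "'a set \<Rightarrow> (('a \<Rightarrow> real) \<Rightarrow> real) \<Rightarrow> real" where
  "expect A F = (\<Sum>T\<in>Pow A. F (signs T)) / 2 ^ card A"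

lemma signs_cases: "signs T a = 1 \<or> signs T a = -1"
  by (simp add: signs_def)

lemma signs_square [simp]: "signs T a * signs T a = 1"
  by (simp add: signs_def)

lemma sum_Pow_insert:
  assumes "finite I" "i \<notin> I"
  shows "(\<Sum>S\<in>Pow (insert i I). f S) = (\<Sum>S\<in>Pow I. f S + f (insert i S))"
proof -
  have inj: "inj_on (insert i) (Pow I)"
    using assms(2) by (auto simp: inj_on_def)
  have "(\<Sum>S\<in>Pow (insert i I). f S) = sum f (Pow I) + sum f (insert i ` Pow I)"
    unfolding Pow_insert using assms by (intro sum.union_disjoint) auto
  then show ?thesis by (simp add: sum.reindex[OF inj] sum.distrib)
qed

lemma expect_empty [simp]: "expect {} F = F (\<lambda>_. 1)"
  by (simp add: expect_def signs_def[abs_def])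

lemma expect_insert:
  assumes "finite A" "a \<notin> A"
  shows "expect (insert a A) F
    = (expect A (\<lambda>e. F (e(a := 1))) + expect A (\<lambda>e. F (e(a := -1)))) / 2"
proof -
  have plus: "(signs T)(a := 1) = signs T" if "T \<in> Pow A" for T
    using that assms(2) by (auto simp: signs_def fun_eq_iff)
  have minus: "(signs T)(a := -1) = signs (insert a T)" for T
    by (auto simp: signs_def)
  show ?thesis
    using assms plus unfolding expect_def minus
    by (simp add: sum_Pow_insert sum.distrib field_simps)
qed

lemma expect_cong:
  assumes "\<And>T. T \<subseteq> A \<Longrightarrow> F (signs T) = G (signs T)"
  shows "expect A F = expect A G"
  unfolding expect_def using assms by (auto intro!: arg_cong2[where f = "(/)"] sum.cong)

lemma expect_mono:
  assumes "\<And>T. T \<subseteq> A \<Longrightarrow> F (signs T) \<le> G (signs T)"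
  shows "expect A F \<le> expect A G"
  unfolding expect_def using assms by (intro divide_right_mono sum_mono) auto

lemma expect_const [simp]: "finite A \<Longrightarrow> expect A (\<lambda>_. c) = c"
  by (simp add: expect_def card_Pow)

lemma expect_add: "expect A (\<lambda>e. F e + G e) = expect A F + expect A G"
  by (simp add: expect_def sum.distrib add_divide_distrib)

lemma expect_diff: "expect A (\<lambda>e. F e - G e) = expect A F - expect A G"
  by (simp add: expect_def sum_subtractf diff_divide_distrib)

lemma expect_cmult: "expect A (\<lambda>e. c * F e) = c * expect A F"
  by (simp add: expect_def sum_distrib_left)

lemma expect_sum: "expect A (\<lambda>e. \<Sum>k\<in>K. F k e) = (\<Sum>k\<in>K. expect A (F k))"
proof -
  have "(\<Sum>T\<in>Pow A. \<Sum>k\<in>K. F k (signs T)) = (\<Sum>k\<in>K. \<Sum>T\<in>Pow A. F k (signs T))"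
    by (rule sum.swap)
  then show ?thesis by (simp add: expect_def sum_divide_distrib)
qed

lemma expect_swap:
  "expect A (\<lambda>e. expect B (\<lambda>f. F e f)) = expect B (\<lambda>f. expect A (\<lambda>e. F e f))"
proof -
  have "(\<Sum>T\<in>Pow A. \<Sum>V\<in>Pow B. F (signs T) (signs V))
      = (\<Sum>V\<in>Pow B. \<Sum>T\<in>Pow A. F (signs T) (signs V))"
    by (rule sum.swap)
  then show ?thesis by (simp add: expect_def sum_divide_distrib[symmetric] mult.commute)
qed

lemma expect_nonneg:
  assumes "\<And>T. T \<subseteq> A \<Longrightarrow> 0 \<le> F (signs T)"
  shows "0 \<le> expect A F"
  unfolding expect_def using assms by (auto intro!: divide_nonneg_nonneg sum_nonneg)

text \<open>The probabilistic method: some outcome is no worse than the average.\<close>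
lemma expect_attains_le:
  assumes "finite A"
  obtains T where "T \<subseteq> A" "F (signs T) \<le> expect A F"
proof -
  have "\<exists>T\<in>Pow A. F (signs T) \<le> expect A F"
  proof (rule ccontr)
    assume "\<not> ?thesis"
    then have "(\<Sum>T\<in>Pow A. expect A F) < (\<Sum>T\<in>Pow A. F (signs T))"
      using assms by (intro sum_strict_mono) (auto simp: not_le)
    then show False
      using assms by (simp add: expect_def card_Pow)
  qed
  then show ?thesis using that by blast
qed

lemma expect_Cauchy_Schwarz:
  "(expect A (\<lambda>e. F e * G e))\<^sup>2 \<le> expect A (\<lambda>e. (F e)\<^sup>2) * expect A (\<lambda>e. (G e)\<^sup>2)"
proof -
  have "(\<Sum>T\<in>Pow A. F (signs T) * G (signs T))\<^sup>2
      \<le> (\<Sum>T\<in>Pow A. (F (signs T))\<^sup>2) * (\<Sum>T\<in>Pow A. (G (signs T))\<^sup>2)"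
    by (rule Cauchy_Schwarz_ineq_sum)
  then show ?thesis
    by (simp add: expect_def power_divide power2_eq_square divide_right_mono)
qed

lemma expect_sqrt_le:
  assumes "finite A" "\<And>T. T \<subseteq> A \<Longrightarrow> 0 \<le> F (signs T)"
  shows "expect A (\<lambda>e. sqrt (F e)) \<le> sqrt (expect A F)"
proof -
  have "(expect A (\<lambda>e. sqrt (F e) * 1))\<^sup>2
      \<le> expect A (\<lambda>e. (sqrt (F e))\<^sup>2) * expect A (\<lambda>e. 1\<^sup>2)"
    by (rule expect_Cauchy_Schwarz)
  also have "expect A (\<lambda>e. (sqrt (F e))\<^sup>2) = expect A F"
    using assms(2) by (intro expect_cong) simp
  finally show ?thesis
    using assms(1) by (intro real_le_rsqrt) simp
qed

lemma expect_odd: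
  assumes "finite A" "i \<in> A" "\<And>e. F (e(i := -1)) = - F (e(i := 1))"
  shows "expect A F = 0"
proof -
  have "expect A F = expect (insert i (A - {i})) F"
    using assms(2) by (simp add: insert_absorb)
  also have "\<dots> = 0"
    using assms(1,3) expect_cmult[of "A - {i}" "-1"] by (subst expect_insert) simp_all
  finally show ?thesis .
qed

lemma expect_correlation:
  assumes "finite A" "i \<in> A" "j \<in> A"
  shows "expect A (\<lambda>e. e i * e j) = (if i = j then 1 else 0)"
proof (cases "i = j")
  case True
  have "expect A (\<lambda>e. e i * e i) = expect A (\<lambda>e. 1)"
    by (intro expect_cong) simp
  then show ?thesis using True assms(1) by simp
next
  case False
  then show ?thesis using expect_odd[OF assms(1,2), of "\<lambda>e. e i * e j"] by simp
qed

lemma expect_coordinate: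
  assumes "finite A" "i \<in> A"
  shows "expect A (\<lambda>e. e i) = 0"
  using expect_odd[OF assms, of "\<lambda>e. e i"] by simp

section \<open>Comparison of a random multilinear polynomial with a random linear form\<close>

text \<open>The comparison step: one random sign on \<open>\<phi>\<close> is replaced by independent random signs on all
the coordinates that \<open>\<phi>\<close> depends on.  Let \<open>x\<close> and \<open>y\<close> be maximizers of the two terms on the left.
If \<open>\<phi>\<close> takes the same value at both, the two contributions of \<open>\<phi>\<close> cancel, and the fresh signs
cost nothing because they have mean zero.  Otherwise \<open>x\<close> and \<open>y\<close> differ in some coordinate \<open>k\<close>.
On the right the maximum may be bounded below by the value at \<open>x\<close> or at \<open>y\<close>, chosen according to
the sign \<open>x k * e k\<close>; this gains 1 on average, which is all that \<open>\<phi>\<close> can contribute on the left.\<close>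
lemma Max_contraction:
  fixes t \<phi> :: "('a \<Rightarrow> real) \<Rightarrow> real"
  assumes X: "finite X" "X \<noteq> {}" and S: "finite S"
    and signs_X: "\<And>x i. x \<in> X \<Longrightarrow> i \<in> S \<Longrightarrow> x i = 1 \<or> x i = -1"
    and phi: "\<And>x. x \<in> X \<Longrightarrow> \<phi> x = 1 \<or> \<phi> x = -1"
    and dep: "\<And>x y. x \<in> X \<Longrightarrow> y \<in> X \<Longrightarrow> \<phi> x \<noteq> \<phi> y \<Longrightarrow> \<exists>i\<in>S. x i \<noteq> y i"
  shows "(Max ((\<lambda>x. t x + \<phi> x) ` X) + Max ((\<lambda>x. t x - \<phi> x) ` X)) / 2
    \<le> expect S (\<lambda>e. Max ((\<lambda>x. t x + (\<Sum>i\<in>S. e i * x i)) ` X))"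
proof -
  define R where "R e x = t x + (\<Sum>i\<in>S. e i * x i)" for e x
  have "Max ((\<lambda>x. t x + \<phi> x) ` X) \<in> (\<lambda>x. t x + \<phi> x) ` X"
    using X by (intro Max_in) auto
  then obtain x where x: "x \<in> X" "Max ((\<lambda>x. t x + \<phi> x) ` X) = t x + \<phi> x" by blast
  have "Max ((\<lambda>x. t x - \<phi> x) ` X) \<in> (\<lambda>x. t x - \<phi> x) ` X"
    using X by (intro Max_in) auto
  then obtain y where y: "y \<in> X" "Max ((\<lambda>x. t x - \<phi> x) ` X) = t y - \<phi> y" by blast
  have le_Max: "R e z \<le> Max (R e ` X)" if "z \<in> X" for e z
    using X that by (intro Max_ge) auto
  have mean: "expect S (\<lambda>e. R e z) = t z" for z
    using S by (simp add: R_def expect_add expect_sum expect_coordinate mult.commute[of _ "z _"]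
        expect_cmult)
  show ?thesis
  proof (cases "\<phi> x = \<phi> y")
    case True
    have "(R e x + R e y) / 2 \<le> Max (R e ` X)" for e
      using le_Max[OF x(1), of e] le_Max[OF y(1), of e] by simp
    then have "expect S (\<lambda>e. (R e x + R e y) / 2) \<le> expect S (\<lambda>e. Max (R e ` X))"
      by (intro expect_mono)
    moreover have "expect S (\<lambda>e. (R e x + R e y) / 2) = (t x + t y) / 2"
      using expect_cmult[of S "1/2" "\<lambda>e. R e x + R e y"] by (simp add: expect_add mean)
    ultimately show ?thesis using True x(2) y(2) by (simp add: R_def)
  next
    case False
    then obtain k where k: "k \<in> S" "x k \<noteq> y k" using dep x y by blast
    have xy: "x k * x k = 1" "x k * y k = -1"
      using signs_X[OF x(1) k(1)] signs_X[OF y(1) k(1)] k(2) by auto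
    have corr: "expect S (\<lambda>e. e k * R e z) = z k" for z
    proof -
      have "e k * R e z = t z * e k + (\<Sum>i\<in>S. z i * (e k * e i))" for e
        by (simp add: R_def distrib_left sum_distrib_left mult_ac)
      then have "expect S (\<lambda>e. e k * R e z) = (\<Sum>i\<in>S. z i * (if k = i then 1 else 0))"
        using S k(1)
        by (simp only: expect_add expect_sum expect_cmult expect_coordinate expect_correlation
            cong: sum.cong)
      also have "\<dots> = z k"
        using S k(1) by (simp add: if_distrib[of "\<lambda>u. _ * u"] cong: if_cong)
      finally show ?thesis .
    qed
    \<comment> \<open>For each sign vector, \<open>G\<close> is the value at \<open>x\<close> if \<open>x k * e k = 1\<close> and the value at \<open>y\<close> if
        \<open>x k * e k = -1\<close>, written so that its average can be computed by linearity.\<close>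
    define G where
      "G e = (1/2) * (R e x + R e y + (x k * (e k * R e x) - x k * (e k * R e y)))" for e
    have G_le: "expect S G \<le> expect S (\<lambda>e. Max (R e ` X))"
    proof (rule expect_mono)
      fix T
      have "x k * signs T k = 1 \<or> x k * signs T k = -1"
        using signs_X[OF x(1) k(1)] signs_cases[of T k] by auto
      moreover have "2 * G (signs T) = R (signs T) x + R (signs T) y
          + (x k * signs T k) * (R (signs T) x - R (signs T) y)"
        by (simp add: G_def algebra_simps)
      ultimately have "G (signs T) = R (signs T) x \<or> G (signs T) = R (signs T) y"
        by auto
      then show "G (signs T) \<le> Max (R (signs T) ` X)" using le_Max x(1) y(1) by auto
    qed
    have "expect S G = (t x + t y) / 2 + 1"
      unfolding G_def expect_cmult expect_add expect_diff mean corr xy by simp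
    moreover have "\<phi> x - \<phi> y \<le> 2" using phi[OF x(1)] phi[OF y(1)] by auto
    ultimately have "(t x + \<phi> x + (t y - \<phi> y)) / 2 \<le> expect S G" by (simp add: field_simps)
    then show ?thesis using G_le unfolding x(2) y(2) R_def by (rule order_trans)
  qed
qed

text \<open>Iterating the comparison over all monomials.  The linear part \<open>c\<close> makes the induction work:
the signs that replace the monomial of \<open>j\<close> are added to \<open>c\<close>, and averaging over them turns
\<open>(c i)\<^sup>2\<close> into \<open>(c i)\<^sup>2 + 1\<close> for \<open>i \<in> S j\<close>, by concavity of the square root.\<close>
lemma expect_Max_le:
  fixes c :: "'a \<Rightarrow> real" and S :: "'b \<Rightarrow> 'a set"
  assumes X: "finite X" "X \<noteq> {}" and I: "finite I" and J: "finite J"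
    and signs_X: "\<And>x i. x \<in> X \<Longrightarrow> i \<in> I \<Longrightarrow> x i = 1 \<or> x i = -1"
    and S: "\<And>j. j \<in> J \<Longrightarrow> S j \<subseteq> I"
  shows "expect J (\<lambda>e. Max ((\<lambda>x. (\<Sum>i\<in>I. c i * x i) + (\<Sum>j\<in>J. e j * (\<Prod>i\<in>S j. x i))) ` X))
    \<le> (\<Sum>i\<in>I. sqrt ((c i)\<^sup>2 + real (card {j \<in> J. i \<in> S j})))"
  using J S
proof (induction J arbitrary: c rule: finite_induct)
  case empty
  have "(\<Sum>i\<in>I. c i * x i) \<le> (\<Sum>i\<in>I. \<bar>c i\<bar>)" if "x \<in> X" for x
    using signs_X[OF that] by (intro sum_mono) fastforce
  then show ?case using X by simp
next
  case (insert j J)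
  have Sj: "S j \<subseteq> I" and finS: "finite (S j)" using insert.prems finite_subset[OF _ I] by auto
  define \<phi> where "\<phi> x = (\<Prod>i\<in>S j. x i)" for x :: "'a \<Rightarrow> real"
  define t where "t e x = (\<Sum>i\<in>I. c i * x i) + (\<Sum>j\<in>J. e j * (\<Prod>i\<in>S j. x i))"
    for e and x :: "'a \<Rightarrow> real"
  define c' where "c' \<delta> i = c i + (if i \<in> S j then \<delta> i else 0)" for \<delta> i
  define m where "m i = real (card {j \<in> J. i \<in> S j})" for i
  let ?F = "\<lambda>J e. Max ((\<lambda>x. (\<Sum>i\<in>I. c i * x i) + (\<Sum>j\<in>J. e j * (\<Prod>i\<in>S j. x i))) ` X)"
  have upd: "?F (insert j J) (e(j := s)) = Max ((\<lambda>x. t e x + s * \<phi> x) ` X)" for e s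
  proof -
    have "(\<Sum>k\<in>J. (e(j := s)) k * (\<Prod>i\<in>S k. x i)) = (\<Sum>k\<in>J. e k * (\<Prod>i\<in>S k. x i))"
      for x :: "'a \<Rightarrow> real"
      using insert.hyps(2) by (intro sum.cong) auto
    then show ?thesis
      using insert.hyps by (simp add: t_def \<phi>_def algebra_simps)
  qed
  have phi: "\<phi> x = 1 \<or> \<phi> x = -1" if "x \<in> X" for x
  proof -
    have "\<bar>\<phi> x\<bar> = (\<Prod>i\<in>S j. 1)"
      unfolding \<phi>_def abs_prod using signs_X[OF that] Sj by (intro prod.cong) fastforce+
    then show ?thesis by (simp add: abs_if split: if_splits)
  qed
  have "expect (insert j J) (?F (insert j J))
      = expect J (\<lambda>e. (Max ((\<lambda>x. t e x + \<phi> x) ` X) + Max ((\<lambda>x. t e x - \<phi> x) ` X)) / 2)"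
    unfolding expect_insert[OF insert.hyps] upd
    using expect_cmult[of J "1/2"
        "\<lambda>e. Max ((\<lambda>x. t e x + \<phi> x) ` X) + Max ((\<lambda>x. t e x - \<phi> x) ` X)"]
    by (simp add: expect_add)
  \<comment> \<open>The signs of the other monomials are fixed; they only enter the function \<open>t e\<close>.\<close>
  also have "\<dots> \<le> expect J (\<lambda>e. expect (S j)
      (\<lambda>\<delta>. Max ((\<lambda>x. t e x + (\<Sum>i\<in>S j. \<delta> i * x i)) ` X)))"
  proof (intro expect_mono Max_contraction[OF X finS])
    show "x i = 1 \<or> x i = -1" if "x \<in> X" "i \<in> S j" for x i
      using signs_X that Sj by auto
    show "\<exists>i\<in>S j. x i \<noteq> y i" if "\<phi> x \<noteq> \<phi> y" for x y
      using that unfolding \<phi>_def by (metis prod.cong)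
  qed (use phi in auto)
  also have "\<dots> = expect (S j) (\<lambda>\<delta>. expect J (\<lambda>e. Max ((\<lambda>x. (\<Sum>i\<in>I. c' \<delta> i * x i)
      + (\<Sum>j\<in>J. e j * (\<Prod>i\<in>S j. x i))) ` X)))"
  proof -
    have "(\<Sum>i\<in>I. c' \<delta> i * x i) = (\<Sum>i\<in>I. c i * x i) + (\<Sum>i\<in>S j. \<delta> i * x i)" for \<delta> x
    proof -
      have "(\<Sum>i\<in>I. (if i \<in> S j then \<delta> i * x i else 0)) = (\<Sum>i\<in>S j. \<delta> i * x i)"
        using I Sj by (simp add: sum.inter_restrict[symmetric] Int_absorb1)
      then show ?thesis
        by (simp add: c'_def distrib_right sum.distrib if_distrib[of "\<lambda>u. u * _"] cong: if_cong)
    qed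
    then show ?thesis
      by (subst expect_swap) (simp add: t_def add_ac)
  qed
  also have "\<dots> \<le> expect (S j) (\<lambda>\<delta>. \<Sum>i\<in>I. sqrt ((c' \<delta> i)\<^sup>2 + m i))"
    unfolding m_def using insert.prems by (intro expect_mono insert.IH) auto
  also have "\<dots> = (\<Sum>i\<in>I. expect (S j) (\<lambda>\<delta>. sqrt ((c' \<delta> i)\<^sup>2 + m i)))"
    by (rule expect_sum)
  also have "\<dots> \<le> (\<Sum>i\<in>I. sqrt ((c i)\<^sup>2 + real (card {j' \<in> insert j J. i \<in> S j'})))"
  proof (rule sum_mono)
    fix i
    have "expect (S j) (\<lambda>\<delta>. sqrt ((c' \<delta> i)\<^sup>2 + m i))
        \<le> sqrt (expect (S j) (\<lambda>\<delta>. (c' \<delta> i)\<^sup>2 + m i))"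
      using finS by (intro expect_sqrt_le) (auto simp: m_def)
    also have "expect (S j) (\<lambda>\<delta>. (c' \<delta> i)\<^sup>2 + m i)
        = (c i)\<^sup>2 + real (card {j' \<in> insert j J. i \<in> S j'})"
    proof (cases "i \<in> S j")
      case True
      have "{j' \<in> insert j J. i \<in> S j'} = insert j {j' \<in> J. i \<in> S j'}" using True by auto
      moreover have "expect (S j) (\<lambda>\<delta>. (c' \<delta> i)\<^sup>2 + m i)
          = expect (S j) (\<lambda>\<delta>. ((c i)\<^sup>2 + m i) + (2 * c i * \<delta> i + \<delta> i * \<delta> i))"
        using True by (intro expect_cong) (simp add: c'_def power2_eq_square algebra_simps)
      ultimately show ?thesis
        using True insert.hyps finS
        by (simp add: expect_add expect_cmult expect_coordinate expect_correlation m_def)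
    next
      case False
      then have "{j' \<in> insert j J. i \<in> S j'} = {j' \<in> J. i \<in> S j'}" by auto
      then show ?thesis using False finS by (simp add: c'_def m_def)
    qed
    finally show "expect (S j) (\<lambda>\<delta>. sqrt ((c' \<delta> i)\<^sup>2 + m i))
        \<le> sqrt ((c i)\<^sup>2 + real (card {j' \<in> insert j J. i \<in> S j'}))" .
  qed
  finally show ?case .
qed

section \<open>Multilinear polynomials on the cube\<close>

definition mlp :: "'a set \<Rightarrow> ('a set \<Rightarrow> real) \<Rightarrow> ('a \<Rightarrow> real) \<Rightarrow> real" where
  "mlp I a x = (\<Sum>S\<in>Pow I. a S * (\<Prod>i\<in>S. x i))"

lemma mlp_insert:
  assumes "finite I" "i \<notin> I"
  shows "mlp (insert i I) a x = mlp I a x + x i * mlp I (\<lambda>S. a (insert i S)) x"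
proof -
  have "a (insert i S) * (\<Prod>j\<in>insert i S. x j) = x i * (a (insert i S) * (\<Prod>j\<in>S. x j))"
    if "S \<in> Pow I" for S
  proof -
    have "finite S" "i \<notin> S" using that assms finite_subset by auto
    then show ?thesis by simp
  qed
  then have "(\<Sum>S\<in>Pow I. a (insert i S) * (\<Prod>j\<in>insert i S. x j))
      = x i * mlp I (\<lambda>S. a (insert i S)) x"
    unfolding mlp_def sum_distrib_left by (intro sum.cong refl)
  then show ?thesis
    unfolding mlp_def[of "insert i I"] mlp_def[of I a] sum_Pow_insert[OF assms] sum.distrib by simp
qed

lemma mlp_cong:
  assumes "\<And>i. i \<in> I \<Longrightarrow> x i = y i"
  shows "mlp I a x = mlp I a y"
  unfolding mlp_def using assms by (intro sum.cong arg_cong2[where f = "(*)"] prod.cong) auto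

lemma mlp_upd [simp]: "i \<notin> I \<Longrightarrow> mlp I a (x(i := v)) = mlp I a x"
  by (rule mlp_cong) auto

lemma mlp_empty [simp]: "mlp {} a x = a {}"
  by (simp add: mlp_def)

text \<open>An affine function of one variable on \<open>[-1, 1]\<close> is bounded by its values at the two endpoints.
The coordinates are moved to endpoints one at a time; \<open>A\<close> is the set of those still to be moved.\<close>
lemma abs_mlp_le_vertices:
  assumes "finite I" and vertices: "\<And>T. T \<subseteq> I \<Longrightarrow> \<bar>mlp I a (signs T)\<bar> \<le> B"
    and "\<And>i. i \<in> I \<Longrightarrow> \<bar>x i\<bar> \<le> 1"
  shows "\<bar>mlp I a x\<bar> \<le> B"
proof -
  have "\<bar>mlp I a x\<bar> \<le> B"
    if "finite A" "A \<subseteq> I" "\<forall>i\<in>A. \<bar>x i\<bar> \<le> 1" "\<forall>i\<in>I - A. x i = 1 \<or> x i = -1" for A x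
    using that
  proof (induction A arbitrary: x rule: finite_induct)
    case empty
    have "mlp I a x = mlp I a (signs {i \<in> I. x i = -1})"
      using empty by (intro mlp_cong) (auto simp: signs_def)
    then show ?case using vertices[of "{i \<in> I. x i = -1}"] by auto
  next
    case (insert i A)
    have I: "I = insert i (I - {i})" using insert.prems by auto
    define p q where "p = mlp (I - {i}) a x" and "q = mlp (I - {i}) (\<lambda>S. a (insert i S)) x"
    have split: "mlp I a (x(i := v)) = p + v * q" for v
      using assms(1) by (subst I, subst mlp_insert) (auto simp: p_def q_def)
    have "\<bar>mlp I a (x(i := v))\<bar> \<le> B" if "v = 1 \<or> v = -1" for v
      using insert.prems insert.hyps(2) that by (intro insert.IH) auto
    from this[of 1] this[of "-1"] have "\<bar>p + q\<bar> \<le> B" "\<bar>p - q\<bar> \<le> B"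
      by (simp_all add: split)
    moreover have "\<bar>x i\<bar> \<le> 1" using insert.prems by auto
    then have "\<bar>x i * q\<bar> \<le> \<bar>q\<bar>" by (simp add: abs_mult mult_left_le_one_le)
    ultimately have "\<bar>p + x i * q\<bar> \<le> B" by linarith
    then show ?case using split[of "x i"] by simp
  qed
  from this[of I x] show ?thesis using assms by auto
qed

lemma Parseval:
  assumes "finite I"
  shows "expect I (\<lambda>x. (mlp I a x)\<^sup>2) = (\<Sum>S\<in>Pow I. (a S)\<^sup>2)"
  using assms
proof (induction I arbitrary: a rule: finite_induct)
  case (insert i I)
  let ?p = "mlp I a" and ?q = "mlp I (\<lambda>S. a (insert i S))"
  have "expect (insert i I) (\<lambda>x. (mlp (insert i I) a x)\<^sup>2)
      = expect I (\<lambda>x. ((?p x + ?q x)\<^sup>2 + (?p x - ?q x)\<^sup>2) / 2)"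
    using insert.hyps expect_cmult[of I "1/2" "\<lambda>x. (?p x + ?q x)\<^sup>2 + (?p x - ?q x)\<^sup>2"]
    by (simp add: expect_insert mlp_insert expect_add)
  also have "\<dots> = expect I (\<lambda>x. (?p x)\<^sup>2 + (?q x)\<^sup>2)"
    by (intro expect_cong) (simp add: power2_sum power2_diff add_divide_distrib)
  finally show ?case
    using insert by (simp add: expect_add sum_Pow_insert sum.distrib)
qed simp

text \<open>Bonami's hypercontractive inequality between the fourth and the second moment.
Splitting off a variable gives \<open>p + x i * q\<close> where \<open>q\<close> has degree bound \<open>k - 1\<close>.  Odd powers of
\<open>x i\<close> average out, so the fourth moment is that of \<open>p\<close>, plus that of \<open>q\<close>, plus six times the
mixed term, and Cauchy-Schwarz bounds the mixed term.  The lower degree of \<open>q\<close> saves a factor 9,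
which pays for \<open>6 = 2 * sqrt 9\<close>.\<close>
lemma Bonami:
  assumes "finite I" "\<And>S. S \<subseteq> I \<Longrightarrow> k < card S \<Longrightarrow> a S = 0"
  shows "expect I (\<lambda>x. (mlp I a x) ^ 4) \<le> 9 ^ k * (expect I (\<lambda>x. (mlp I a x)\<^sup>2))\<^sup>2"
  using assms
proof (induction I arbitrary: a k rule: finite_induct)
  case (insert i I)
  define p where "p = mlp I a"
  define q where "q = mlp I (\<lambda>S. a (insert i S))"
  define P where "P = expect I (\<lambda>x. (p x)\<^sup>2)"
  define Q where "Q = expect I (\<lambda>x. (q x)\<^sup>2)"
  define P4 where "P4 = expect I (\<lambda>x. (p x) ^ 4)"
  define Q4 where "Q4 = expect I (\<lambda>x. (q x) ^ 4)"
  define M where "M = expect I (\<lambda>x. (p x)\<^sup>2 * (q x)\<^sup>2)"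
  have nonneg: "0 \<le> P" "0 \<le> Q" "0 \<le> P4" "0 \<le> Q4" "0 \<le> M"
    by (auto simp: P_def Q_def P4_def Q4_def M_def intro!: expect_nonneg)
  have two: "expect (insert i I) (\<lambda>x. (mlp (insert i I) a x)\<^sup>2) = P + Q"
    using insert.hyps
    by (simp add: P_def Q_def p_def q_def Parseval sum_Pow_insert sum.distrib)
  have "expect (insert i I) (\<lambda>x. (mlp (insert i I) a x) ^ 4)
      = expect I (\<lambda>x. (1/2) * ((p x + q x) ^ 4 + (p x - q x) ^ 4))"
    unfolding expect_cmult expect_add using insert.hyps
    by (simp add: expect_insert mlp_insert p_def q_def)
  also have "\<dots> = expect I (\<lambda>x. (p x) ^ 4 + 6 * ((p x)\<^sup>2 * (q x)\<^sup>2) + (q x) ^ 4)"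
    by (intro expect_cong) (simp add: eval_nat_numeral algebra_simps)
  also have "\<dots> = P4 + 6 * M + Q4"
    by (simp add: expect_add expect_cmult P4_def M_def Q4_def)
  finally have four: "expect (insert i I) (\<lambda>x. (mlp (insert i I) a x) ^ 4) = P4 + 6 * M + Q4" .
  have P4: "P4 \<le> 9 ^ k * P\<^sup>2"
    unfolding P4_def P_def p_def using insert.prems by (intro insert.IH) auto
  have "P4 + 6 * M + Q4 \<le> 9 ^ k * (P + Q)\<^sup>2"
  proof (cases k)
    case 0
    have "a (insert i S) = 0" if "S \<subseteq> I" for S
    proof -
      have "0 < card (insert i S)"
        using finite_subset[OF that insert.hyps(1)] by (simp add: card_gt_0_iff)
      then show ?thesis using that 0 by (intro insert.prems) auto
    qed
    then have "q = (\<lambda>x. 0)" by (auto simp: q_def mlp_def fun_eq_iff intro!: sum.neutral)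
    then have "M = 0" "Q4 = 0" "Q = 0" using insert.hyps by (simp_all add: M_def Q4_def Q_def)
    then show ?thesis using P4 by simp
  next
    case (Suc l)
    have "Q4 \<le> 9 ^ l * Q\<^sup>2"
      unfolding Q4_def Q_def q_def
    proof (intro insert.IH)
      fix S assume "S \<subseteq> I" "l < card S"
      moreover from this have "i \<notin> S" "finite S"
        using insert.hyps finite_subset by auto
      ultimately show "a (insert i S) = 0"
        using Suc by (intro insert.prems) auto
    qed
    then have Q4: "9 * Q4 \<le> 9 ^ k * Q\<^sup>2" using Suc by simp
    have "M\<^sup>2 \<le> P4 * Q4"
      unfolding M_def P4_def Q4_def
      using expect_Cauchy_Schwarz[of I "\<lambda>x. (p x)\<^sup>2" "\<lambda>x. (q x)\<^sup>2"]
      by (simp add: power_mult[symmetric])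
    then have "(3 * M)\<^sup>2 \<le> P4 * (9 * Q4)" by (simp add: power_mult_distrib)
    also have "\<dots> \<le> (9 ^ k * P\<^sup>2) * (9 ^ k * Q\<^sup>2)"
      using nonneg by (intro mult_mono[OF P4 Q4]) auto
    also have "\<dots> = (9 ^ k * P * Q)\<^sup>2" by (simp add: power2_eq_square mult_ac)
    finally have M: "3 * M \<le> 9 ^ k * P * Q"
      using nonneg by (rule_tac power2_le_imp_le) auto
    have "Q4 \<le> 9 ^ k * Q\<^sup>2" using Q4 nonneg by linarith
    then show ?thesis
      using P4 M by (simp add: power2_sum distrib_left mult_ac)
  qed
  then show ?case unfolding two four .
next
  case empty
  have "1 * (a {}) ^ 4 \<le> 9 ^ k * (a {}) ^ 4" by (intro mult_right_mono) auto
  then show ?case by simp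
qed

text \<open>First and second moments are comparable for bounded degree: Hoelder interpolation between the
moments one and four, combined with \<open>Bonami\<close>.  The interpolation is carried out by the pointwise
inequality \<open>3 z\<^sup>2 \<le> 2 z + z^4\<close> for \<open>z \<ge> 0\<close>, that is \<open>z (z - 1)\<^sup>2 (z + 2) \<ge> 0\<close>, at the scale
\<open>c\<close> at which the fourth moment is at most \<open>c\<^sup>2\<close> times the second, so nothing is lost.\<close>
lemma sqrt_expect_square_le:
  assumes "finite I" "\<And>S. S \<subseteq> I \<Longrightarrow> k < card S \<Longrightarrow> a S = 0"
  shows "sqrt (expect I (\<lambda>x. (mlp I a x)\<^sup>2)) \<le> 3 ^ k * expect I (\<lambda>x. \<bar>mlp I a x\<bar>)"
proof -
  define m where "m = expect I (\<lambda>x. (mlp I a x)\<^sup>2)"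
  define c where "c = 3 ^ k * sqrt m"
  have m: "0 \<le> m" unfolding m_def by (rule expect_nonneg) simp
  show ?thesis
  proof (cases "m = 0")
    case True
    then show ?thesis by (simp add: m_def[symmetric] expect_nonneg)
  next
    case False
    with m have c: "0 < c" by (simp add: c_def)
    have c2: "c\<^sup>2 = 9 ^ k * m"
      using m by (simp add: c_def power_mult_distrib power_mult[symmetric] mult.commute[of k])
        (simp add: power_mult)
    have pointwise: "3 * c\<^sup>2 * y\<^sup>2 \<le> 2 * c ^ 3 * \<bar>y\<bar> + y ^ 4" for y
    proof -
      have "0 \<le> \<bar>y\<bar> * (\<bar>y\<bar> - c)\<^sup>2 * (\<bar>y\<bar> + 2 * c)" using c by simp
      also have "\<dots> = 2 * c ^ 3 * \<bar>y\<bar> + \<bar>y\<bar> ^ 4 - 3 * c\<^sup>2 * \<bar>y\<bar>\<^sup>2"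
        by (simp add: eval_nat_numeral algebra_simps)
      finally show ?thesis by simp
    qed
    have "expect I (\<lambda>x. 3 * c\<^sup>2 * (mlp I a x)\<^sup>2)
        \<le> expect I (\<lambda>x. 2 * c ^ 3 * \<bar>mlp I a x\<bar> + (mlp I a x) ^ 4)"
      using pointwise by (intro expect_mono)
    then have "3 * c\<^sup>2 * m \<le> 2 * c ^ 3 * expect I (\<lambda>x. \<bar>mlp I a x\<bar>)
        + expect I (\<lambda>x. (mlp I a x) ^ 4)"
      by (simp only: expect_cmult expect_add m_def)
    also have "expect I (\<lambda>x. (mlp I a x) ^ 4) \<le> c\<^sup>2 * m"
      using Bonami[of I k a, OF assms] by (simp add: m_def[symmetric] c2 power2_eq_square[of m])
    finally have "c\<^sup>2 * m \<le> c\<^sup>2 * (c * expect I (\<lambda>x. \<bar>mlp I a x\<bar>))"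
      by (simp add: eval_nat_numeral)
    then have "m \<le> c * expect I (\<lambda>x. \<bar>mlp I a x\<bar>)" using c by simp
    then have "sqrt m * sqrt m \<le> sqrt m * (3 ^ k * expect I (\<lambda>x. \<bar>mlp I a x\<bar>))"
      using m by (simp add: c_def mult_ac)
    moreover have "0 < sqrt m" using False m by simp
    ultimately show ?thesis unfolding m_def[symmetric] by (rule mult_left_le_imp_le)
  qed
qed

section \<open>Markov's inequality at an endpoint\<close>

fun chebyshev :: "nat \<Rightarrow> real poly" where
  "chebyshev 0 = 1"
| "chebyshev (Suc 0) = [:0, 1:]"
| "chebyshev (Suc (Suc n)) = [:0, 2:] * chebyshev (Suc n) - chebyshev n"

lemma degree_chebyshev: "degree (chebyshev n) \<le> n"
proof (induction n rule: chebyshev.induct)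
  case (3 n)
  have "degree ([:0, 2:] * chebyshev (Suc n)) \<le> 1 + Suc n"
    using degree_mult_le[of "[:0, 2:]" "chebyshev (Suc n)"] 3(1) by simp
  then show ?case using 3(2) by (simp add: degree_diff_le)
qed simp_all

lemma poly_chebyshev_cos: "poly (chebyshev n) (cos \<theta>) = cos (real n * \<theta>)"
proof (induction n rule: chebyshev.induct)
  case (3 n)
  have "cos (real (Suc (Suc n)) * \<theta>) + cos (real n * \<theta>) = 2 * cos \<theta> * cos (real (Suc n) * \<theta>)"
    using cos_add[of "real (Suc n) * \<theta>" \<theta>] cos_diff[of "real (Suc n) * \<theta>" \<theta>]
    by (simp add: algebra_simps)
  then show ?case using 3 by simp
qed simp_all

lemma poly_chebyshev_1: "poly (chebyshev n) 1 = 1"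
  using poly_chebyshev_cos[of n 0] by simp

lemma poly_pderiv_chebyshev_1: "poly (pderiv (chebyshev n)) 1 = (real n)\<^sup>2"
proof (induction n rule: chebyshev.induct)
  case (3 n)
  then show ?case
    by (simp add: pderiv_mult pderiv_diff pderiv_smult pderiv_pCons poly_chebyshev_1 power2_eq_square
        algebra_simps)
qed (simp_all add: pderiv_pCons)

text \<open>The Chebyshev polynomial is extremal.  If the derivative of \<open>p\<close> at 1 were larger, a multiple \<open>c T\<close>
of the Chebyshev polynomial \<open>T\<close> with \<open>\<bar>c\<bar> > M\<close> would have the same derivative at 1.  At the \<open>d + 1\<close>
points where \<open>T\<close> alternates between 1 and -1, the difference \<open>q = c T - p\<close> has alternating signs.
So \<open>q\<close> has \<open>d\<close> zeros between them, and by Rolle \<open>pderiv q\<close> has \<open>d - 1\<close> zeros below 1, besides the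
zero at 1.  These are more zeros than its degree admits, so \<open>q\<close> is constant, which contradicts
the alternation.\<close>
lemma Markov_endpoint:
  fixes p :: "real poly"
  assumes deg: "degree p \<le> d" and d: "1 \<le> d"
    and bound: "\<And>s. \<bar>s\<bar> \<le> 1 \<Longrightarrow> \<bar>poly p s\<bar> \<le> M"
  shows "\<bar>poly (pderiv p) 1\<bar> \<le> (real d)\<^sup>2 * M"
proof (rule ccontr)
  assume contra: "\<not> ?thesis"
  define c where "c = poly (pderiv p) 1 / (real d)\<^sup>2"
  define q where "q = smult c (chebyshev d) - p"
  define \<xi> where "\<xi> j = cos (real j * pi / real d)" for j
  have cM: "M < \<bar>c\<bar>"
    using contra d by (simp add: c_def abs_divide field_simps)
  have q1: "poly (pderiv q) 1 = 0"
    using d by (simp add: q_def pderiv_diff pderiv_smult poly_pderiv_chebyshev_1 c_def)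
  have deg_q: "degree q \<le> d"
    unfolding q_def using deg degree_chebyshev[of d]
    by (intro degree_diff_le) (auto intro: order_trans[OF degree_smult_le])
  have sign: "0 < c * (-1) ^ j * poly q (\<xi> j)" if "j \<le> d" for j
  proof -
    have "poly (chebyshev d) (\<xi> j) = (-1) ^ j"
      using d by (simp add: \<xi>_def poly_chebyshev_cos mult.commute[of _ pi])
    then have "c * (-1) ^ j * poly q (\<xi> j) = \<bar>c\<bar>\<^sup>2 - c * (-1) ^ j * poly p (\<xi> j)"
      by (simp add: q_def right_diff_distrib power2_eq_square mult_ac power_mult_distrib[symmetric])
    moreover have "\<bar>c * (-1) ^ j * poly p (\<xi> j)\<bar> \<le> \<bar>c\<bar> * M"
      using bound[of "\<xi> j"] by (simp add: abs_mult \<xi>_def mult_left_mono)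
    moreover have "0 \<le> M" using bound[of 0] by simp
    then have "\<bar>c\<bar> * M < \<bar>c\<bar>\<^sup>2"
      unfolding power2_eq_square using cM by (intro mult_strict_left_mono) auto
    ultimately show ?thesis by linarith
  qed
  have alternate: "poly q (\<xi> (Suc j)) * poly q (\<xi> j) < 0" if "j < d" for j
  proof -
    have "0 < (c * (-1) ^ j * poly q (\<xi> j)) * (c * (-1) ^ Suc j * poly q (\<xi> (Suc j)))"
      using that by (intro mult_pos_pos[OF sign sign]) auto
    also have "\<dots> = - (c\<^sup>2 * (poly q (\<xi> (Suc j)) * poly q (\<xi> j)))"
      by (simp add: power2_eq_square mult_ac power_mult_distrib[symmetric])
    finally show ?thesis by (simp add: mult_less_0_iff)
  qed
  have decreasing: "\<xi> (Suc j) < \<xi> j" if "j < d" for j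
  proof -
    have "real (Suc j) * pi \<le> real d * pi" using that by (intro mult_right_mono) auto
    then show ?thesis
      unfolding \<xi>_def using d by (intro cos_monotone_0_pi) (auto simp: field_simps)
  qed
  have "\<exists>r. \<xi> (Suc j) < r \<and> r < \<xi> j \<and> poly q r = 0" if "j < d" for j
    using poly_IVT[OF decreasing alternate] that by auto
  then obtain r where r: "\<xi> (Suc j) < r j" "r j < \<xi> j" "poly q (r j) = 0" if "j < d" for j
    by metis
  have "\<exists>s. r (Suc j) < s \<and> s < r j \<and> poly (pderiv q) s = 0" if "Suc j < d" for j
  proof -
    have "r (Suc j) < r j" using r(2)[OF that] r(1)[of j] that by simp
    then show ?thesis using poly_MVT[of "r (Suc j)" "r j" q] r(3)[of j] r(3)[of "Suc j"] that by auto
  qed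
  then obtain s where s: "r (Suc j) < s j" "s j < r j" "poly (pderiv q) (s j) = 0"
    if "Suc j < d" for j
    by metis
  have step: "s (Suc j) < s j" if "Suc (Suc j) < d" for j
    using s(2)[of "Suc j"] s(1)[of j] that by simp
  have mono: "s (j + Suc k) < s j" if "Suc (j + Suc k) < d" for j k
    using that
  proof (induction k)
    case (Suc k)
    then show ?case using step[of "j + Suc k"] by simp
  qed (use step in simp)
  have "s j \<noteq> s k" if "j < k" "Suc k < d" for j k
    using mono[of j "k - j - 1"] that by simp
  then have "inj_on s {..<d - 1}"
    by (intro linorder_inj_onI) auto
  then have "card (s ` {..<d - 1}) = d - 1" by (simp add: card_image)
  moreover have "s j < 1" if "j < d - 1" for j
  proof -
    have "\<xi> j \<le> 1" by (simp add: \<xi>_def)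
    then show ?thesis using s(2)[of j] r(2)[of j] that by linarith
  qed
  then have "1 \<notin> s ` {..<d - 1}" by force
  ultimately have card: "card (insert 1 (s ` {..<d - 1})) = d" using d by simp
  have "pderiv q = 0"
  proof (rule ccontr)
    assume nz: "pderiv q \<noteq> 0"
    have "insert 1 (s ` {..<d - 1}) \<subseteq> {x. poly (pderiv q) x = 0}"
      using q1 s(3) by auto
    then have "d \<le> degree (pderiv q)"
      using card_mono[OF poly_roots_finite[OF nz]] card card_poly_roots_bound[OF nz]
      by (metis order_trans)
    then show False using deg_q d by (simp add: degree_pderiv)
  qed
  then have "poly q (\<xi> 1) = poly q (\<xi> 0)"
    using pderiv_iszero[of q] by auto
  then show False using alternate[of 0] d by (simp add: mult_less_0_iff)
qed

section \<open>Total influence\<close>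

text \<open>Differentiating with respect to \<open>x i\<close> deletes \<open>i\<close> from the monomials that contain it.  The value 0
on sets that contain \<open>i\<close> keeps \<open>I\<close> as the index set of the derivative, so that all partial derivatives
are averaged over the same sample space.\<close>
definition partial :: "'a \<Rightarrow> ('a set \<Rightarrow> real) \<Rightarrow> 'a set \<Rightarrow> real" where
  "partial i a S = (if i \<in> S then 0 else a (insert i S))"

lemma sum_Pow_remove:
  assumes "finite I" "i \<in> I"
  shows "(\<Sum>S\<in>Pow I. if i \<in> S then 0 else f (insert i S)) = (\<Sum>S | S \<subseteq> I \<and> i \<in> S. f S)"
proof -
  have "(\<Sum>S\<in>Pow I. if i \<in> S then 0 else f (insert i S))
      = (\<Sum>S | S \<subseteq> I \<and> i \<notin> S. f (insert i S))"
    using assms(1) by (intro sum.mono_neutral_cong_right) auto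
  also have "\<dots> = (\<Sum>S | S \<subseteq> I \<and> i \<in> S. f S)"
    using assms(2)
    by (intro sum.reindex_bij_witness[of _ "\<lambda>S. S - {i}" "insert i"]) (auto simp: insert_absorb)
  finally show ?thesis .
qed

lemma mlp_partial:
  assumes "finite I" "i \<in> I"
  shows "mlp I (partial i a) x = (\<Sum>S | S \<subseteq> I \<and> i \<in> S. a S * (\<Prod>j\<in>S - {i}. x j))"
proof -
  have "mlp I (partial i a) x
      = (\<Sum>S\<in>Pow I. if i \<in> S then 0 else a (insert i S) * (\<Prod>j\<in>insert i S - {i}. x j))"
    by (auto simp: mlp_def partial_def intro!: sum.cong)
  also have "\<dots> = (\<Sum>S | S \<subseteq> I \<and> i \<in> S. a S * (\<Prod>j\<in>S - {i}. x j))"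
    by (rule sum_Pow_remove[OF assms])
  finally show ?thesis .
qed

lemma mlp_partial_upd:
  assumes "finite I" "i \<in> I"
  shows "mlp I (partial i a) (x(i := v)) = mlp I (partial i a) x"
  unfolding mlp_partial[OF assms]
  by (intro sum.cong refl arg_cong2[where f = "(*)"] prod.cong) auto

text \<open>Bound on \<open>\<Sum>\<^sub>i E \<bar>D\<^sub>i\<bar>\<close>.  The segment from \<open>x\<close> to the point \<open>y\<close> with coordinates
\<open>sgn (D\<^sub>i x)\<close> stays in the cube.  It is parametrized by \<open>[-1, 1]\<close> with \<open>x\<close> at the parameter 1, so
that \<open>Markov_endpoint\<close> applies to the restriction \<open>L\<close> of the polynomial to it.\<close>
lemma total_L1_influence_le:
  assumes I: "finite I" and deg: "\<And>S. S \<subseteq> I \<Longrightarrow> d < card S \<Longrightarrow> a S = 0" and d: "1 \<le> d"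
    and bound: "\<And>x. (\<And>i. i \<in> I \<Longrightarrow> \<bar>x i\<bar> \<le> 1) \<Longrightarrow> \<bar>mlp I a x\<bar> \<le> M"
  shows "(\<Sum>i\<in>I. expect I (\<lambda>x. \<bar>mlp I (partial i a) x\<bar>)) \<le> 2 * (real d)\<^sup>2 * M"
proof -
  define D where "D i x = mlp I (partial i a) x" for i x
  have pointwise: "(\<Sum>i\<in>I. \<bar>D i x\<bar>) \<le> 2 * (real d)\<^sup>2 * M + (\<Sum>i\<in>I. x i * D i x)"
    if x: "\<And>i. i \<in> I \<Longrightarrow> \<bar>x i\<bar> \<le> 1" for x
  proof -
    define y where "y i = sgn (D i x)" for i
    define f where "f i = [:(x i + y i) / 2, (x i - y i) / 2:]" for i
    define L where "L = (\<Sum>S\<in>Pow I. smult (a S) (\<Prod>i\<in>S. f i))"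
    have L: "poly L s = mlp I a (\<lambda>i. (x i + y i) / 2 + s * ((x i - y i) / 2))" for s
      by (simp add: L_def mlp_def poly_sum poly_prod f_def)
    have "\<bar>poly L s\<bar> \<le> M" if s: "\<bar>s\<bar> \<le> 1" for s
      unfolding L
    proof (rule bound)
      fix i assume "i \<in> I"
      have "\<bar>(1 + s) * x i + (1 - s) * y i\<bar> \<le> \<bar>1 + s\<bar> * \<bar>x i\<bar> + \<bar>1 - s\<bar> * \<bar>y i\<bar>"
        unfolding abs_mult[symmetric] by (rule abs_triangle_ineq)
      also have "\<dots> \<le> \<bar>1 + s\<bar> * 1 + \<bar>1 - s\<bar> * 1"
        using x[OF \<open>i \<in> I\<close>] by (intro add_mono mult_left_mono) (auto simp: y_def sgn_if)
      also have "\<dots> = 2" using s by simp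
      finally show "\<bar>(x i + y i) / 2 + s * ((x i - y i) / 2)\<bar> \<le> 1"
        by (simp add: field_simps)
    qed
    moreover have "degree L \<le> d"
      unfolding L_def
    proof (rule degree_sum_le)
      fix S assume S: "S \<in> Pow I"
      then have fin: "finite S" using I finite_subset by auto
      have "degree (f i) \<le> 1" for i by (simp add: f_def split: if_split)
      then have "degree (\<Prod>i\<in>S. f i) \<le> (\<Sum>i\<in>S. 1)"
        by (intro order_trans[OF degree_prod_sum_le[OF fin] sum_mono]) simp
      then show "degree (smult (a S) (\<Prod>i\<in>S. f i)) \<le> d"
        using deg[of S] S by (cases "a S = 0") (auto simp: not_less[symmetric])
    qed (use I in simp)
    ultimately have Markov: "\<bar>poly (pderiv L) 1\<bar> \<le> (real d)\<^sup>2 * M"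
      using d by (intro Markov_endpoint)
    have "poly (pderiv L) 1
        = (\<Sum>S\<in>Pow I. \<Sum>i\<in>S. a S * (\<Prod>j\<in>S - {i}. x j) * ((x i - y i) / 2))"
      by (simp add: L_def higher_pderiv_sum[of 1, simplified] pderiv_smult pderiv_prod poly_sum poly_prod f_def
          pderiv_pCons sum_distrib_left mult.assoc add_divide_distrib[symmetric] field_simps)
    also have "\<dots> = (\<Sum>S\<in>Pow I. \<Sum>i\<in>{i \<in> I. i \<in> S}. a S * (\<Prod>j\<in>S - {i}. x j) * ((x i - y i) / 2))"
      by (intro sum.cong) auto
    also have "\<dots> = (\<Sum>i\<in>I. \<Sum>S\<in>{S \<in> Pow I. i \<in> S}. a S * (\<Prod>j\<in>S - {i}. x j) * ((x i - y i) / 2))"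
      using I by (intro sum.swap_restrict) auto
    also have "\<dots> = (\<Sum>i\<in>I. D i x * ((x i - y i) / 2))"
      using I by (intro sum.cong) (auto simp: D_def mlp_partial sum_distrib_right)
    also have "\<dots> = ((\<Sum>i\<in>I. x i * D i x) - (\<Sum>i\<in>I. \<bar>D i x\<bar>)) / 2"
      by (simp add: y_def abs_sgn sum_subtractf[symmetric] sum_divide_distrib algebra_simps)
    finally have "- (((\<Sum>i\<in>I. x i * D i x) - (\<Sum>i\<in>I. \<bar>D i x\<bar>)) / 2) \<le> (real d)\<^sup>2 * M"
      using Markov by (simp only: abs_le_iff)
    then show ?thesis by (simp add: field_simps)
  qed
  have centred: "expect I (\<lambda>x. x i * D i x) = 0" if "i \<in> I" for i
    using I that by (intro expect_odd[of _ i]) (simp_all add: D_def mlp_partial_upd)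
  have "expect I (\<lambda>x. \<Sum>i\<in>I. \<bar>D i x\<bar>)
      \<le> expect I (\<lambda>x. 2 * (real d)\<^sup>2 * M + (\<Sum>i\<in>I. x i * D i x))"
    by (intro expect_mono pointwise) (simp add: signs_def)
  then show ?thesis
    using I centred by (simp add: expect_sum expect_add D_def)
qed

lemma sum_sqrt_occurrences_le:
  assumes I: "finite I" and deg: "\<And>S. S \<subseteq> I \<Longrightarrow> d < card S \<Longrightarrow> a S = 0" and d: "1 \<le> d"
    and bound: "\<And>x. (\<And>i. i \<in> I \<Longrightarrow> \<bar>x i\<bar> \<le> 1) \<Longrightarrow> \<bar>mlp I a x\<bar> \<le> M"
  shows "(\<Sum>i\<in>I. sqrt (\<Sum>S | S \<subseteq> I \<and> i \<in> S. (a S)\<^sup>2)) \<le> 3 ^ (d - 1) * (2 * (real d)\<^sup>2) * M"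
proof -
  have "sqrt (\<Sum>S | S \<subseteq> I \<and> i \<in> S. (a S)\<^sup>2) \<le> 3 ^ (d - 1) * expect I (\<lambda>x. \<bar>mlp I (partial i a) x\<bar>)"
    if i: "i \<in> I" for i
  proof -
    have "expect I (\<lambda>x. (mlp I (partial i a) x)\<^sup>2)
        = (\<Sum>S\<in>Pow I. if i \<in> S then 0 else (a (insert i S))\<^sup>2)"
      unfolding Parseval[OF I] by (intro sum.cong) (auto simp: partial_def)
    also have "\<dots> = (\<Sum>S | S \<subseteq> I \<and> i \<in> S. (a S)\<^sup>2)"
      by (rule sum_Pow_remove[OF I i])
    finally have "sqrt (\<Sum>S | S \<subseteq> I \<and> i \<in> S. (a S)\<^sup>2)
        = sqrt (expect I (\<lambda>x. (mlp I (partial i a) x)\<^sup>2))" by simp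
    also have "\<dots> \<le> 3 ^ (d - 1) * expect I (\<lambda>x. \<bar>mlp I (partial i a) x\<bar>)"
    proof (rule sqrt_expect_square_le[OF I])
      fix S assume S: "S \<subseteq> I" "d - 1 < card S"
      then have "i \<notin> S \<Longrightarrow> d < card (insert i S)" using finite_subset[OF S(1) I] by simp
      then show "partial i a S = 0"
        using deg[of "insert i S"] S i by (simp add: partial_def)
    qed
    finally show ?thesis .
  qed
  then have "(\<Sum>i\<in>I. sqrt (\<Sum>S | S \<subseteq> I \<and> i \<in> S. (a S)\<^sup>2))
      \<le> 3 ^ (d - 1) * (\<Sum>i\<in>I. expect I (\<lambda>x. \<bar>mlp I (partial i a) x\<bar>))"
    unfolding sum_distrib_left by (rule sum_mono)
  also have "\<dots> \<le> 3 ^ (d - 1) * (2 * (real d)\<^sup>2 * M)"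
    using total_L1_influence_le[OF assms] by (intro mult_left_mono) auto
  finally show ?thesis by (simp add: mult_ac)
qed

lemma sqrt_sum_squares_le:
  assumes I: "finite I" and bound: "\<And>x. (\<And>i. i \<in> I \<Longrightarrow> \<bar>x i\<bar> \<le> 1) \<Longrightarrow> \<bar>mlp I a x\<bar> \<le> M"
  shows "sqrt (\<Sum>S\<in>Pow I. (a S)\<^sup>2) \<le> M"
proof -
  have M: "0 \<le> M" using bound[of "\<lambda>_. 0"] by simp
  have "(mlp I a (signs T))\<^sup>2 \<le> M\<^sup>2" for T
    using bound[of "signs T"] M by (intro abs_le_square_iff[THEN iffD1]) (simp add: signs_def)
  then have "expect I (\<lambda>x. (mlp I a x)\<^sup>2) \<le> expect I (\<lambda>_. M\<^sup>2)"
    by (intro expect_mono)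
  then show ?thesis using I M by (simp add: Parseval real_le_lsqrt)
qed

section \<open>Exponential moments and the union bound\<close>

text \<open>The function \<open>exp (- x\<^sup>2 / 2) * cosh x\<close> has derivative \<open>exp (- x\<^sup>2 / 2) * (sinh x - x * cosh x)\<close>,
which is nonpositive for \<open>x \<ge> 0\<close>.\<close>
lemma cosh_le_exp_half_square: "cosh x \<le> exp (x\<^sup>2 / 2)" for x :: real
proof -
  have nonneg: "cosh x \<le> exp (x\<^sup>2 / 2)" if "0 \<le> x" for x :: real
  proof -
    have sinh_le: "sinh y \<le> y * cosh y" if "0 \<le> y" for y :: real
    proof -
      have "(\<lambda>y. y * cosh y - sinh y) 0 \<le> (\<lambda>y. y * cosh y - sinh y) y"
      proof (rule DERIV_nonneg_imp_nondecreasing[OF that])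
        fix z :: real assume "0 \<le> z" "z \<le> y"
        then show "\<exists>D. ((\<lambda>y. y * cosh y - sinh y) has_real_derivative D) (at z) \<and> 0 \<le> D"
          by (intro exI[of _ "z * sinh z"]) (auto intro!: derivative_eq_intros)
      qed
      then show ?thesis by simp
    qed
    have "(\<lambda>y. exp (- (y\<^sup>2 / 2)) * cosh y) x \<le> (\<lambda>y. exp (- (y\<^sup>2 / 2)) * cosh y) 0"
    proof (rule DERIV_nonpos_imp_nonincreasing[OF that])
      fix z :: real assume "0 \<le> z" "z \<le> x"
      then have "exp (- (z\<^sup>2 / 2)) * (sinh z - z * cosh z) \<le> 0"
        using sinh_le by (intro mult_nonneg_nonpos) auto
      then show "\<exists>D. ((\<lambda>y. exp (- (y\<^sup>2 / 2)) * cosh y) has_real_derivative D) (at z) \<and> D \<le> 0"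
        by (intro exI[of _ "exp (- (z\<^sup>2 / 2)) * (sinh z - z * cosh z)"])
          (auto intro!: derivative_eq_intros simp: algebra_simps)
    qed
    then show ?thesis by (simp add: exp_minus field_simps)
  qed
  show ?thesis using nonneg[of "\<bar>x\<bar>"] by simp
qed

lemma expect_exp_sum:
  assumes "finite J"
  shows "expect J (\<lambda>e. exp (\<Sum>j\<in>J. e j * b j)) = (\<Prod>j\<in>J. cosh (b j))"
  using assms
proof (induction J rule: finite_induct)
  case (insert j J)
  have "(\<Sum>k\<in>J. (e(j := s)) k * b k) = (\<Sum>k\<in>J. e k * b k)" for e s
    using insert.hyps(2) by (intro sum.cong) auto
  then have "expect (insert j J) (\<lambda>e. exp (\<Sum>k\<in>insert j J. e k * b k))
      = (exp (b j) * expect J (\<lambda>e. exp (\<Sum>k\<in>J. e k * b k))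
        + exp (- b j) * expect J (\<lambda>e. exp (\<Sum>k\<in>J. e k * b k))) / 2"
    using insert.hyps by (simp add: expect_insert exp_add exp_diff exp_minus expect_cmult[symmetric] field_simps)
  then show ?case
    using insert by (simp add: cosh_field_def field_simps)
qed simp

text \<open>Chernoff bound with the union bound over \<open>X\<close> and over the sign of the sum.  The parameter \<open>l\<close>
balances the entropy \<open>L\<close> against the variance term \<open>u * l\<^sup>2 / 2\<close>: they become equal.\<close>
lemma exists_signs_union_bound:
  fixes b :: "'x \<Rightarrow> 'j \<Rightarrow> real"
  assumes X: "finite X" "X \<noteq> {}" and J: "finite J" "J \<noteq> {}"
    and b: "\<And>x j. x \<in> X \<Longrightarrow> j \<in> J \<Longrightarrow> b x j = 1 \<or> b x j = -1"
  obtains T where "T \<subseteq> J"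
    "\<And>x. x \<in> X \<Longrightarrow> \<bar>\<Sum>j\<in>J. signs T j * b x j\<bar> \<le> sqrt (2 * ln (2 * real (card X)) * real (card J))"
proof -
  define L where "L = ln (2 * real (card X))"
  define u where "u = real (card J)"
  define l where "l = sqrt (2 * L / u)"
  define h where "h e x = (\<Sum>j\<in>J. e j * b x j)" for e x
  define F where "F e = (\<Sum>x\<in>X. exp (l * h e x) + exp (- l * h e x))" for e
  have "card X \<ge> 1" using X by (simp add: Suc_leI card_gt_0_iff)
  then have L: "0 < L" "exp L = 2 * real (card X)" by (simp_all add: L_def)
  have u: "0 < u" using J by (simp add: u_def card_gt_0_iff)
  have l: "0 < l" "l\<^sup>2 = 2 * L / u" using L u by (simp_all add: l_def)
  have moment: "expect J (\<lambda>e. exp (t * h e x)) = cosh l ^ card J" if "x \<in> X" "\<bar>t\<bar> = l" for t x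
  proof -
    have cosh_l: "cosh (t * b x j) = cosh l" if "j \<in> J" for j
      using b[OF \<open>x \<in> X\<close> that] cosh_real_abs[of t] \<open>\<bar>t\<bar> = l\<close> by auto
    have "(\<Prod>j\<in>J. cosh (t * b x j)) = (\<Prod>j\<in>J. cosh l)"
      by (intro prod.cong refl cosh_l)
    then show ?thesis
      using expect_exp_sum[OF J(1), of "\<lambda>j. t * b x j"]
      by (simp add: h_def sum_distrib_left mult_ac)
  qed
  have "expect J F = (\<Sum>x\<in>X. 2 * cosh l ^ card J)"
    unfolding F_def expect_sum expect_add using moment[of _ l] moment[of _ "- l"] l
    by (intro sum.cong) auto
  also have "\<dots> = exp L * cosh l ^ card J" by (simp add: L)
  also have "\<dots> \<le> exp L * exp (l\<^sup>2 / 2) ^ card J"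
    by (intro mult_left_mono power_mono cosh_le_exp_half_square) auto
  also have "\<dots> = exp (L + u * (l\<^sup>2 / 2))"
    by (simp add: exp_add exp_of_nat_mult[symmetric] u_def)
  also have "L + u * (l\<^sup>2 / 2) = 2 * L" using u by (simp add: l)
  finally have "expect J F \<le> exp (2 * L)" .
  moreover obtain T where T: "T \<subseteq> J" "F (signs T) \<le> expect J F"
    using expect_attains_le[OF J(1)] .
  ultimately have FT: "F (signs T) \<le> exp (2 * L)" by simp
  have "\<bar>h (signs T) x\<bar> \<le> sqrt (2 * L * u)" if "x \<in> X" for x
  proof -
    have "exp (l * \<bar>h (signs T) x\<bar>) \<le> exp (l * h (signs T) x) + exp (- l * h (signs T) x)"
      by (cases "0 \<le> h (signs T) x") auto
    also have "\<dots> \<le> F (signs T)"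
      unfolding F_def using X that by (intro member_le_sum) auto
    also note FT
    finally have "l * \<bar>h (signs T) x\<bar> \<le> 2 * L" by simp
    also have "2 * L = l * sqrt (2 * L * u)"
    proof -
      have "2 * L / u * (2 * L * u) = (2 * L)\<^sup>2"
        using u by (simp add: power2_eq_square)
      then have "l * sqrt (2 * L * u) = sqrt ((2 * L)\<^sup>2)"
        unfolding l_def real_sqrt_mult[symmetric] by simp
      then show ?thesis using L by (simp only: real_sqrt_abs abs_of_pos mult_pos_pos zero_less_numeral)
    qed
    finally show ?thesis using l by simp
  qed
  then show ?thesis using that T by (auto simp: h_def L_def u_def)
qed

text \<open>The additional index \<open>z\<close> is a variable that multiplies every monomial.  Its two values turn the
maximum of the polynomial into the maximum of its absolute value, at the price of one more term in
\<open>expect_Max_le\<close>; as \<open>z\<close> occurs in all monomials, that term is \<open>sqrt (card U)\<close>.\<close>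
lemma exists_signs_sum_sqrt_bound:
  fixes U :: "'a set set"
  assumes I: "finite I" "z \<notin> I" and U: "U \<subseteq> Pow I"
  obtains T where "T \<subseteq> U"
    "\<And>V. V \<subseteq> I \<Longrightarrow> \<bar>\<Sum>S\<in>U. signs T S * (\<Prod>i\<in>S. signs V i)\<bar>
      \<le> sqrt (real (card U)) + (\<Sum>i\<in>I. sqrt (real (card {S \<in> U. i \<in> S})))"
proof -
  define X where "X = (signs :: 'a set \<Rightarrow> 'a \<Rightarrow> real) ` Pow (insert z I)"
  define h where "h e x = (\<Sum>S\<in>U. e S * (\<Prod>i\<in>S. x i))" for e and x :: "'a \<Rightarrow> real"
  have fin: "finite U" "finite X" "X \<noteq> {}" using I U finite_subset by (auto simp: X_def)
  have factor: "(\<Sum>S\<in>U. e S * (\<Prod>i\<in>insert z S. x i)) = x z * h e x" for e x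
  proof -
    have "(\<Prod>i\<in>insert z S. x i) = x z * (\<Prod>i\<in>S. x i)" if "S \<in> U" for S
      using that I U by (subst prod.insert) (auto intro: finite_subset)
    then show ?thesis by (simp add: h_def sum_distrib_left mult_ac)
  qed
  have "expect U (\<lambda>e. Max ((\<lambda>x. (\<Sum>i\<in>insert z I. 0 * x i)
        + (\<Sum>S\<in>U. e S * (\<Prod>i\<in>insert z S. x i))) ` X))
      \<le> (\<Sum>i\<in>insert z I. sqrt (0\<^sup>2 + real (card {S \<in> U. i \<in> insert z S})))"
    using I U fin by (intro expect_Max_le) (auto simp: X_def signs_def split: if_splits)
  then have "expect U (\<lambda>e. Max ((\<lambda>x. x z * h e x) ` X))
      \<le> (\<Sum>i\<in>insert z I. sqrt (real (card {S \<in> U. i = z \<or> i \<in> S})))"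
    by (simp add: factor)
  also have "\<dots> = sqrt (real (card U)) + (\<Sum>i\<in>I. sqrt (real (card {S \<in> U. i \<in> S})))"
  proof -
    have "{S \<in> U. i = z \<or> i \<in> S} = {S \<in> U. i \<in> S}" if "i \<in> I" for i
      using that I by auto
    then show ?thesis using I by simp
  qed
  finally have mean: "expect U (\<lambda>e. Max ((\<lambda>x. x z * h e x) ` X))
      \<le> sqrt (real (card U)) + (\<Sum>i\<in>I. sqrt (real (card {S \<in> U. i \<in> S})))" .
  obtain T where T: "T \<subseteq> U" "Max ((\<lambda>x. x z * h (signs T) x) ` X)
      \<le> expect U (\<lambda>e. Max ((\<lambda>x. x z * h e x) ` X))"
    by (rule expect_attains_le[OF fin(1), of "\<lambda>e. Max ((\<lambda>x. x z * h e x) ` X)"]) (rule that)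
  have "\<bar>h (signs T) (signs V)\<bar> \<le> Max ((\<lambda>x. x z * h (signs T) x) ` X)" if V: "V \<subseteq> I" for V
  proof -
    have same: "h (signs T) (signs (insert z V)) = h (signs T) (signs V)"
      unfolding h_def using I U
      by (intro sum.cong refl arg_cong2[where f = "(*)"] prod.cong) (auto simp: signs_def)
    have le: "x z * h (signs T) x \<le> Max ((\<lambda>x. x z * h (signs T) x) ` X)" if "x \<in> X" for x
      using fin that by (intro Max_ge) auto
    have "signs V z = 1" using V I by (auto simp: signs_def)
    then have "h (signs T) (signs V) \<le> Max ((\<lambda>x. x z * h (signs T) x) ` X)"
      using le[of "signs V"] V by (auto simp: X_def)
    moreover have "- h (signs T) (signs V) \<le> Max ((\<lambda>x. x z * h (signs T) x) ` X)"
      using le[of "signs (insert z V)"] V same by (auto simp: X_def signs_def[of _ z])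
    ultimately show ?thesis by (simp add: abs_le_iff)
  qed
  then have "\<bar>h (signs T) (signs V)\<bar>
      \<le> sqrt (real (card U)) + (\<Sum>i\<in>I. sqrt (real (card {S \<in> U. i \<in> S})))" if "V \<subseteq> I" for V
    using order_trans[OF T(2) mean] that order_trans by blast
  then show ?thesis using that[OF T(1)] by (simp add: h_def)
qed

section \<open>Littlewood families\<close>

lemma mleval_eq_mlp:
  assumes "finite I" "monomials h \<subseteq> Pow I"
  shows "mleval h x = mlp I h x"
  unfolding mleval_def mlp_def using assms
  by (intro sum.mono_neutral_left) (auto simp: monomials_def)

lemma abs_le_1_on_cube:
  assumes "x \<in> cube n" "i \<in> {1..n}"
  shows "\<bar>x i\<bar> \<le> 1"
proof -
  have "x i \<in> {-1..1}" using assms unfolding cube_def by (rule PiE_mem)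
  then show ?thesis by (simp add: abs_le_iff)
qed

lemma mleval_littlewood:
  assumes "h \<in> littlewood U" "U \<subseteq> Pow {1..n}"
  shows "mleval h x = mlp {1..n} h x"
  using assms by (intro mleval_eq_mlp) (simp_all add: littlewood_def)

lemma bdd_above_on_cube:
  assumes "h \<in> littlewood U" "U \<subseteq> Pow {1..n}"
  shows "bdd_above ((\<lambda>x. \<bar>mleval h x\<bar>) ` cube n)"
proof (rule bdd_aboveI2)
  fix x assume x: "x \<in> cube n"
  let ?B = "Max ((\<lambda>V. \<bar>mlp {1..n} h (signs V)\<bar>) ` Pow {1..n})"
  have "\<bar>mlp {1..n} h (signs V)\<bar> \<le> ?B" if "V \<subseteq> {1..n}" for V
    using that by (intro Max_ge) simp_all
  then show "\<bar>mleval h x\<bar> \<le> ?B"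
    unfolding mleval_littlewood[OF assms]
    using abs_le_1_on_cube[OF x] by (rule abs_mlp_le_vertices[OF finite_atLeastAtMost])
qed

lemma littlewood_min_le:
  assumes h: "h \<in> littlewood U" and U: "U \<subseteq> Pow {1..n}"
    and vertices: "\<And>V. V \<subseteq> {1..n} \<Longrightarrow> \<bar>mleval h (signs V)\<bar> \<le> B"
  shows "littlewood_min n U \<le> B"
proof -
  have cube_ne: "(\<lambda>i. if i \<in> {1..n} then 0 else undefined) \<in> cube n"
    by (auto simp: cube_def)
  have "littlewood_min n U \<le> (SUP x\<in>cube n. \<bar>mleval h x\<bar>)"
    unfolding littlewood_min_def
  proof (rule cINF_lower[OF _ h], rule bdd_belowI2)
    fix g assume "g \<in> littlewood U"
    from cSUP_upper2[OF bdd_above_on_cube[OF this U] cube_ne, of 0]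
    show "0 \<le> (SUP x\<in>cube n. \<bar>mleval g x\<bar>)" by simp
  qed
  also have "\<dots> \<le> B"
  proof (rule cSUP_least)
    fix x assume x: "x \<in> cube n"
    show "\<bar>mleval h x\<bar> \<le> B"
      using vertices abs_le_1_on_cube[OF x] unfolding mleval_littlewood[OF h U]
      by (rule abs_mlp_le_vertices[OF finite_atLeastAtMost])
  qed (use cube_ne in auto)
  finally show ?thesis .
qed

text \<open>A lower bound may be proved for an arbitrary \<open>M\<close> that bounds the polynomial at all points with
coordinates in \<open>[-1, 1]\<close>; this frees the argument from the values that points of \<open>cube n\<close> must take
outside \<open>{1..n}\<close>.\<close>
lemma le_littlewood_min:
  assumes U: "U \<subseteq> Pow {1..n}"
    and lower: "\<And>h M. h \<in> littlewood U \<Longrightarrow>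
      (\<And>x. (\<And>i. i \<in> {1..n} \<Longrightarrow> \<bar>x i\<bar> \<le> 1) \<Longrightarrow> \<bar>mlp {1..n} h x\<bar> \<le> M) \<Longrightarrow> c \<le> M"
  shows "c \<le> littlewood_min n U"
  unfolding littlewood_min_def
proof (rule cINF_greatest)
  have "(\<lambda>S. if S \<in> U then 1 else 0) \<in> littlewood U"
    by (auto simp: littlewood_def monomials_def)
  then show "littlewood U \<noteq> {}" by blast
next
  fix h assume h: "h \<in> littlewood U"
  show "c \<le> (SUP x\<in>cube n. \<bar>mleval h x\<bar>)"
  proof (rule lower[OF h])
    fix x :: "nat \<Rightarrow> real" assume x: "\<And>i. i \<in> {1..n} \<Longrightarrow> \<bar>x i\<bar> \<le> 1"
    have "x i \<in> {-1..1}" if "i \<in> {1..n}" for i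
      using x[OF that] by (simp add: abs_le_iff)
    then have "restrict x {1..n} \<in> cube n" unfolding cube_def by (intro restrict_PiE_iff[THEN iffD2] ballI)
    then have "\<bar>mleval h (restrict x {1..n})\<bar> \<le> (SUP x\<in>cube n. \<bar>mleval h x\<bar>)"
      by (rule cSUP_upper[OF _ bdd_above_on_cube[OF h U]])
    moreover have "mlp {1..n} h (restrict x {1..n}) = mlp {1..n} h x"
      by (rule mlp_cong) simp
    ultimately show "\<bar>mlp {1..n} h x\<bar> \<le> (SUP x\<in>cube n. \<bar>mleval h x\<bar>)"
      by (simp add: mleval_littlewood[OF h U])
  qed
qed

lemma signed_littlewood:
  "(\<lambda>S. if S \<in> U then signs T S else 0) \<in> littlewood U"
  "mleval (\<lambda>S. if S \<in> U then signs T S else 0) x = (\<Sum>S\<in>U. signs T S * (\<Prod>i\<in>S. x i))"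
proof -
  have "monomials (\<lambda>S. if S \<in> U then signs T S else 0) = U"
    by (auto simp: monomials_def signs_def split: if_splits)
  then show "(\<lambda>S. if S \<in> U then signs T S else 0) \<in> littlewood U"
    "mleval (\<lambda>S. if S \<in> U then signs T S else 0) x = (\<Sum>S\<in>U. signs T S * (\<Prod>i\<in>S. x i))"
    by (auto simp: littlewood_def mleval_def signs_def intro!: sum.cong)
qed

lemma littlewood_square_sum:
  assumes "h \<in> littlewood U" "finite A"
  shows "(\<Sum>S\<in>A. (h S)\<^sup>2) = real (card (U \<inter> A))"
proof -
  have "(h S)\<^sup>2 = (if S \<in> U then 1 else 0)" for S
  proof (cases "S \<in> U")
    case True
    then have "h S = -1 \<or> h S = 1" using assms(1) by (auto simp: littlewood_def)
    then show ?thesis using True by auto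
  next
    case False
    then have "h S = 0" using assms(1) by (auto simp: littlewood_def monomials_def)
    then show ?thesis using False by simp
  qed
  then show ?thesis
    using assms(2) by (simp add: sum.If_cases Int_commute)
qed

lemma sqrt_card_le_littlewood_min:
  assumes U: "U \<subseteq> Pow {1..n}"
  shows "sqrt (real (card U)) \<le> littlewood_min n U"
proof (rule le_littlewood_min[OF U])
  fix h M assume h: "h \<in> littlewood U"
    and M: "\<And>x. (\<And>i. i \<in> {1..n} \<Longrightarrow> \<bar>x i\<bar> \<le> 1) \<Longrightarrow> \<bar>mlp {1..n} h x\<bar> \<le> M"
  have "U \<inter> Pow {1..n} = U" using U by auto
  then show "sqrt (real (card U)) \<le> M"
    using sqrt_sum_squares_le[OF _ M] littlewood_square_sum[OF h, of "Pow {1..n}"] by simp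
qed

lemma sum_sqrt_occ_le_littlewood_min:
  assumes U: "U \<subseteq> Pow {1..n}" and deg: "\<And>S. S \<in> U \<Longrightarrow> card S \<le> d" and d: "1 \<le> d"
  shows "(\<Sum>i=1..n. sqrt (real (occ U i))) / (3 ^ (d - 1) * (2 * (real d)\<^sup>2)) \<le> littlewood_min n U"
proof (rule le_littlewood_min[OF U])
  fix h M assume h: "h \<in> littlewood U"
    and M: "\<And>x. (\<And>i. i \<in> {1..n} \<Longrightarrow> \<bar>x i\<bar> \<le> 1) \<Longrightarrow> \<bar>mlp {1..n} h x\<bar> \<le> M"
  have occ: "(\<Sum>S | S \<subseteq> {1..n} \<and> i \<in> S. (h S)\<^sup>2) = real (occ U i)" for i
  proof -
    have "U \<inter> {S. S \<subseteq> {1..n} \<and> i \<in> S} = {S \<in> U. i \<in> S}" using U by auto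
    then show ?thesis
      using littlewood_square_sum[OF h, of "{S. S \<subseteq> {1..n} \<and> i \<in> S}"] by (simp add: occ_def)
  qed
  have "h S = 0" if "d < card S" for S
    using that deg[of S] h by (auto simp: littlewood_def monomials_def)
  then have "(\<Sum>i=1..n. sqrt (real (occ U i))) \<le> 3 ^ (d - 1) * (2 * (real d)\<^sup>2) * M"
    unfolding occ[symmetric] by (intro sum_sqrt_occurrences_le d M) auto
  then show "(\<Sum>i=1..n. sqrt (real (occ U i))) / (3 ^ (d - 1) * (2 * (real d)\<^sup>2)) \<le> M"
    using d by (simp add: field_simps)
qed

lemma littlewood_min_le_union_bound:
  assumes U: "U \<subseteq> Pow {1..n}" "U \<noteq> {}"
  shows "littlewood_min n U \<le> sqrt (2 * (real n + 1) * real (card U))"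
proof -
  define X where "X = (signs :: nat set \<Rightarrow> nat \<Rightarrow> real) ` Pow {1..n}"
  have X: "finite X" "X \<noteq> {}" by (auto simp: X_def)
  have finU: "finite U" using U finite_subset by blast
  have "card X \<le> 2 ^ n" using card_image_le[of "Pow {1..n}" signs] by (simp add: X_def card_Pow)
  then have card_X: "real (card X) \<le> 2 ^ n" by (metis of_nat_le_iff of_nat_numeral of_nat_power)
  have monomial: "(\<Prod>i\<in>S. x i) = 1 \<or> (\<Prod>i\<in>S. x i) = -1" if "x \<in> X" "S \<in> U" for x S
  proof -
    have "\<bar>\<Prod>i\<in>S. x i\<bar> = (\<Prod>i\<in>S. 1)"
      unfolding abs_prod using that by (intro prod.cong) (auto simp: X_def signs_def)
    then show ?thesis by (simp add: abs_if split: if_splits)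
  qed
  obtain T where "T \<subseteq> U" and T: "\<And>x. x \<in> X \<Longrightarrow> \<bar>\<Sum>S\<in>U. signs T S * (\<Prod>i\<in>S. x i)\<bar>
      \<le> sqrt (2 * ln (2 * real (card X)) * real (card U))"
    by (rule exists_signs_union_bound[OF X finU U(2), of "\<lambda>x S. \<Prod>i\<in>S. x i", OF monomial])
      (assumption | rule that)+
  have "ln (2 * real (card X)) \<le> real n + 1"
  proof -
    have "0 < card X" using X by (simp add: card_gt_0_iff)
    then have "ln (2 * real (card X)) \<le> ln (2 ^ Suc n)"
      using card_X by simp
    also have "\<dots> = real (Suc n) * ln 2" by (simp add: ln_realpow del: power_Suc)
    also have "\<dots> \<le> real (Suc n) * 1"
      using ln_le_minus_one[of 2] by (intro mult_left_mono) auto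
    finally show ?thesis by simp
  qed
  then have "sqrt (2 * ln (2 * real (card X)) * real (card U))
      \<le> sqrt (2 * (real n + 1) * real (card U))"
    by (intro real_sqrt_le_mono mult_right_mono) auto
  then have "\<bar>\<Sum>S\<in>U. signs T S * (\<Prod>i\<in>S. signs V i)\<bar>
      \<le> sqrt (2 * (real n + 1) * real (card U))" if "V \<subseteq> {1..n}" for V
    using order_trans[OF T[of "signs V"]] that by (simp add: X_def)
  then show ?thesis
    by (intro littlewood_min_le[OF signed_littlewood(1) U(1)]) (simp add: signed_littlewood(2))
qed

text \<open>The empty monomial must be absent: then every monomial is counted in some \<open>occ U i\<close>, so that
\<open>card U \<le> (\<Sum>i=1..n. occ U i)\<close> and the term \<open>sqrt (card U)\<close> of \<open>exists_signs_sum_sqrt_bound\<close> is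
absorbed.\<close>
lemma littlewood_min_le_sum_sqrt_occ:
  assumes U: "U \<subseteq> Pow {1..n} - {{}}"
  shows "littlewood_min n U \<le> 2 * (\<Sum>i=1..n. sqrt (real (occ U i)))"
proof -
  have U': "U \<subseteq> Pow {1..n}" using U by auto
  then have finU: "finite U" using finite_subset by blast
  have "U \<subseteq> (\<Union>i\<in>{1..n}. {S \<in> U. i \<in> S})"
  proof
    fix S assume "S \<in> U"
    moreover from this obtain i where "i \<in> S" "S \<subseteq> {1..n}" using U by fastforce
    ultimately show "S \<in> (\<Union>i\<in>{1..n}. {S \<in> U. i \<in> S})" by auto
  qed
  then have "card U \<le> card (\<Union>i\<in>{1..n}. {S \<in> U. i \<in> S})"
    using finU by (intro card_mono) auto
  also have "\<dots> \<le> (\<Sum>i=1..n. occ U i)"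
    unfolding occ_def by (rule card_UN_le) simp
  finally have "real (card U) \<le> (\<Sum>i=1..n. (sqrt (real (occ U i)))\<^sup>2)"
    by (simp add: of_nat_sum[symmetric] del: of_nat_sum)
  then have "sqrt (real (card U)) \<le> L2_set (\<lambda>i. sqrt (real (occ U i))) {1..n}"
    unfolding L2_set_def by simp
  also have "\<dots> \<le> (\<Sum>i=1..n. sqrt (real (occ U i)))"
    by (rule L2_set_le_sum) simp
  finally have card_le: "sqrt (real (card U)) \<le> (\<Sum>i=1..n. sqrt (real (occ U i)))" .
  obtain T where "T \<subseteq> U" and T: "\<And>V. V \<subseteq> {1..n} \<Longrightarrow> \<bar>\<Sum>S\<in>U. signs T S * (\<Prod>i\<in>S. signs V i)\<bar>
      \<le> sqrt (real (card U)) + (\<Sum>i=1..n. sqrt (real (card {S \<in> U. i \<in> S})))"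
    using exists_signs_sum_sqrt_bound[of "{1..n}" 0 U] U' by auto
  have "\<bar>mleval (\<lambda>S. if S \<in> U then signs T S else 0) (signs V)\<bar>
      \<le> 2 * (\<Sum>i=1..n. sqrt (real (occ U i)))" if "V \<subseteq> {1..n}" for V
    using T[OF that] card_le unfolding signed_littlewood(2) occ_def by linarith
  then show ?thesis by (rule littlewood_min_le[OF signed_littlewood(1) U'])
qed

text \<open>This follows from \<open>d \<le> 2 * (d - 1)\<close> and \<open>d \<le> d powr (3/2)\<close>.\<close>
lemma influence_constant_le:
  assumes "2 \<le> d"
  shows "2 * (real d)\<^sup>2 \<le> 2 powr (5/2) * (real d - 1) powr (3/2) * real d"
proof -
  have "real d \<le> real d powr (3/2)"
    using assms powr_mono[of 1 "3/2" "real d"] by simp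
  also have "\<dots> \<le> (2 * (real d - 1)) powr (3/2)"
    using assms by (intro powr_mono2) auto
  also have "\<dots> = 2 powr (3/2) * (real d - 1) powr (3/2)"
    by (rule powr_mult)
  finally have "2 * real d \<le> (2 powr 1 * 2 powr (3/2)) * (real d - 1) powr (3/2)"
    by simp
  also have "2 powr 1 * 2 powr (3/2) = (2 powr (5/2) :: real)"
    unfolding powr_add[symmetric] by simp
  finally have "2 * real d * real d \<le> 2 powr (5/2) * (real d - 1) powr (3/2) * real d"
    by (rule mult_right_mono) simp
  then show ?thesis by (simp only: power2_eq_square mult.assoc)
qed

theorem theorem1:
  shows "(\<forall>d\<ge>1. \<exists>c C :: real. 0 < c \<and> c \<le> C \<and>
           (\<forall>n\<ge>1. \<forall>U. degree_bounded n d U \<longrightarrow>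
              c * (\<Sum>i=1..n. sqrt (real (occ U i))) \<le> littlewood_min n U \<and>
              littlewood_min n U \<le> C * (\<Sum>i=1..n. sqrt (real (occ U i)))))
       \<and> (\<forall>n\<ge>1. \<forall>d\<ge>1. \<forall>U. degree_bounded n d U \<longrightarrow>
           (if d = 1 then sqrt (real (card U))
            else max (1 / (3 ^ (d - 1) * 2 powr (5/2) * (real d - 1) powr (3/2) * real d)
                        * (\<Sum>i=1..n. sqrt (real (occ U i))))
                     (sqrt (real (card U))))
             \<le> littlewood_min n U \<and>
           littlewood_min n U
             \<le> min (3.34 * (\<Sum>i=1..n. sqrt (real (occ U i))))
                   (sqrt (2 * (real n + 1) * real (card U))))"
proof -
  define \<sigma> where "\<sigma> n U = (\<Sum>i=1..n. sqrt (real (occ U i)))" for n U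
  have \<sigma>: "0 \<le> \<sigma> n U" for n U by (simp add: \<sigma>_def sum_nonneg)
  have U: "U \<subseteq> Pow {1..n} - {{}}" "U \<subseteq> Pow {1..n}" "U \<noteq> {}" "\<And>S. S \<in> U \<Longrightarrow> card S \<le> d"
    if "degree_bounded n d U" for n d U
  proof -
    show "U \<subseteq> Pow {1..n} - {{}}" "U \<subseteq> Pow {1..n}" "U \<noteq> {}"
      using that by (auto simp: degree_bounded_def)
    then have "finite U" using finite_subset by blast
    then show "card S \<le> d" if "S \<in> U" for S
      using that \<open>degree_bounded n d U\<close> by (auto simp: degree_bounded_def)
  qed
  have lower: "\<sigma> n U / (3 ^ (d - 1) * (2 * (real d)\<^sup>2)) \<le> littlewood_min n U"
    if "degree_bounded n d U" "1 \<le> d" for n d U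
    unfolding \<sigma>_def using that by (intro sum_sqrt_occ_le_littlewood_min U)
  have upper: "littlewood_min n U \<le> 2 * \<sigma> n U" if "degree_bounded n d U" for n d U
    unfolding \<sigma>_def using U(1)[OF that] by (rule littlewood_min_le_sum_sqrt_occ)
  have "\<exists>c C :: real. 0 < c \<and> c \<le> C \<and> (\<forall>n\<ge>1. \<forall>U. degree_bounded n d U \<longrightarrow>
      c * \<sigma> n U \<le> littlewood_min n U \<and> littlewood_min n U \<le> C * \<sigma> n U)" if d: "1 \<le> d" for d
  proof (intro exI conjI allI impI)
    let ?K = "3 ^ (d - 1) * (2 * (real d)\<^sup>2)"
    have "1 * (2 * 1) \<le> ?K" using d by (intro mult_mono) auto
    then show "0 < 1 / ?K" "1 / ?K \<le> 2" by (simp_all add: field_simps)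
    show "1 / ?K * \<sigma> n U \<le> littlewood_min n U" "littlewood_min n U \<le> 2 * \<sigma> n U"
      if "degree_bounded n d U" for n U
      using lower[OF that d] upper[OF that] by simp_all
  qed
  moreover have "(if d = 1 then sqrt (real (card U))
            else max (1 / (3 ^ (d - 1) * 2 powr (5/2) * (real d - 1) powr (3/2) * real d) * \<sigma> n U)
                     (sqrt (real (card U)))) \<le> littlewood_min n U
      \<and> littlewood_min n U \<le> min (3.34 * \<sigma> n U) (sqrt (2 * (real n + 1) * real (card U)))"
    if d: "1 \<le> d" and dU: "degree_bounded n d U" for n d U
  proof -
    have "1 / (3 ^ (d - 1) * 2 powr (5/2) * (real d - 1) powr (3/2) * real d) * \<sigma> n U
        \<le> littlewood_min n U" if "d \<noteq> 1"
    proof -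
      have "\<sigma> n U / (3 ^ (d - 1) * (2 powr (5/2) * (real d - 1) powr (3/2) * real d))
          \<le> \<sigma> n U / (3 ^ (d - 1) * (2 * (real d)\<^sup>2))"
        using that d \<sigma> by (intro divide_left_mono mult_left_mono influence_constant_le) auto
      then show ?thesis using lower[OF dU d] by (simp add: mult.assoc)
    qed
    moreover have "2 * \<sigma> n U \<le> 3.34 * \<sigma> n U" using \<sigma> by (intro mult_right_mono) auto
    ultimately show ?thesis
      using upper[OF dU] sqrt_card_le_littlewood_min[OF U(2)[OF dU]]
        littlewood_min_le_union_bound[OF U(2,3)[OF dU]] by auto
  qed
  ultimately show ?thesis unfolding \<sigma>_def by blast
qed

end
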